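(* Let $N\ge 1$, $0\le u\le N$ and $0\le r\le N$ be integers. Consider a pool of $N$ chunks, of which exactly $u$ are designated as challengers. If $r$ chunks (sentinels) are sampled uniformly at random without replacement from the pool, then the probability $P_{\mathrm{miss}}$ that none of the $u$ challengers is sampled satisfies $$P_{\mathrm{miss}}=\frac{\binom{N-u}{r}}{\binom{N}{r}}\le\left(1-\frac{u}{N}\right)^r.$$
   Context: The pool is the residual set of omitted chunks (those neither in the top-$k$ route nor in the deterministic near-miss sentinel set) for a fixed query row; the challengers are those omitted chunks in the pool that have become competitive enough to enter the top-$k$. Sampling uniformly without replacement means that every $r$-element subset of the pool is equally likely. Conventions: $\binom{M}{r}=0$ when $0\le M<r$, and $x^0=1$ for all real $x$ (including $x=0$). *)

theory Defs
  imports "HOL-Probability.Probability"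
begin

(* The outcome of a draw without replacement is the unordered set of drawn chunks.
   pmf_of_set is only meaningful for a finite nonempty set, i.e. here for a finite
   pool with r \<le> card pool. *)
definition sample_without_replacement :: "'a set \<Rightarrow> nat \<Rightarrow> 'a set pmf" where
  "sample_without_replacement pool r = pmf_of_set {S. S \<subseteq> pool \<and> card S = r}"

definition P_miss :: "'a set \<Rightarrow> 'a set \<Rightarrow> nat \<Rightarrow> real" where
  "P_miss pool challengers r =
     measure_pmf.prob (sample_without_replacement pool r) {S. S \<inter> challengers = {}}"

end

theory Submission
  imports Defs
begin

text \<open>A draw misses every challenger iff it is an \<open>r\<close>-subset of the complement,
  so counting gives the quotient (\<open>P_miss_eq\<close>). That quotient is the product over i < r
  of (N - u - i) / (N - i), and each factor is at most (N - u) / N: removing the same amount from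
  numerator and denominator cannot increase a fraction that is at most 1.
  \<open>binomial_power_cross_le\<close> proves this bound by induction on \<open>r\<close>.\<close>

lemma Suc_times_binomial_Suc: "Suc k * (n choose Suc k) = (n - k) * (n choose k)"
  by (simp only: binomial_absorption binomial_absorb_comp)

text \<open>The bound with denominators cleared. Staying in \<open>nat\<close>, it covers
  \<open>r > m\<close> and \<open>r > n\<close> as well: truncated subtraction turns the factors
  past zero into 0 rather than negative numbers.\<close>

lemma binomial_power_cross_le:
  fixes m n :: nat
  assumes "m \<le> n"
  shows "(m choose r) * n ^ r \<le> m ^ r * (n choose r)"
proof (induction r)
  case 0
  show ?case by simp
next
  case (Suc r)
  \<comment> \<open>After expansion both sides subtract from \<open>m * n\<close>, and
    \<open>r * n\<close> is at least \<open>m * r\<close>.\<close>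
  have factor: "(m - r) * n \<le> m * (n - r)"
    using assms by (simp add: diff_mult_distrib diff_mult_distrib2 mult.commute diff_le_mono2)
  \<comment> \<open>Scaling by \<open>Suc r\<close> lets the recurrence split off one factor of the
    product; the scale is cancelled at the end.\<close>
  have "Suc r * ((m choose Suc r) * n ^ Suc r) = (m - r) * n * ((m choose r) * n ^ r)"
    using Suc_times_binomial_Suc[of r m] by (metis mult.assoc mult.left_commute power_Suc)
  also have "\<dots> \<le> m * (n - r) * (m ^ r * (n choose r))"
    using factor Suc.IH by (rule mult_le_mono)
  also have "\<dots> = Suc r * (m ^ Suc r * (n choose Suc r))"
    using Suc_times_binomial_Suc[of r n] by (metis mult.assoc mult.left_commute power_Suc)
  finally show ?case by (simp only: Suc_mult_le_cancel1)
qed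

lemma P_miss_eq:
  assumes fin: "finite pool" and r: "r \<le> card pool" and sub: "challengers \<subseteq> pool"
  shows "P_miss pool challengers r =
    real ((card pool - card challengers) choose r) / real (card pool choose r)"
proof -
  let ?A = "{S. S \<subseteq> pool \<and> card S = r}"
  have finA: "finite ?A" using fin by simp
  have cardA: "card ?A = card pool choose r" using fin by (rule n_subsets)
  \<comment> \<open>Nonemptiness is what makes \<open>pmf_of_set\<close> the uniform distribution on
    \<open>?A\<close>, so that the probability is a ratio of cardinalities.\<close>
  have "?A \<noteq> {}" using r by (metis cardA card.empty binomial_eq_0_iff not_le)
  moreover have "?A \<inter> {S. S \<inter> challengers = {}} = {S. S \<subseteq> pool - challengers \<and> card S = r}"
    by blast
  moreover have "card {S. S \<subseteq> pool - challengers \<and> card S = r} =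
      (card pool - card challengers) choose r"
    using fin sub by (simp add: n_subsets card_Diff_subset finite_subset)
  ultimately show ?thesis
    using finA by (simp add: P_miss_def sample_without_replacement_def measure_pmf_of_set cardA)
qed

theorem mainTheorem2:
  fixes pool challengers :: "'a set" and N u r :: nat
  assumes "N \<ge> 1" and "u \<le> N" and "r \<le> N"
    and "finite pool" and "card pool = N"
    and "challengers \<subseteq> pool" and "card challengers = u"
  shows "P_miss pool challengers r = real ((N - u) choose r) / real (N choose r)
       \<and> real ((N - u) choose r) / real (N choose r) \<le> (1 - real u / real N) ^ r"
proof
  show "P_miss pool challengers r = real ((N - u) choose r) / real (N choose r)"
    using P_miss_eq[of pool r challengers] assms by simp
next
  have "real ((N - u) choose r) * real N ^ r \<le> real (N - u) ^ r * real (N choose r)"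
    using binomial_power_cross_le[of "N - u" N r]
    by (metis diff_le_self of_nat_le_iff of_nat_mult of_nat_power)
  \<comment> \<open>Both denominators are positive: \<open>N choose r\<close> because
    \<open>r \<le> N\<close>, and \<open>N ^ r\<close> because \<open>N \<ge> 1\<close>.\<close>
  then have "real ((N - u) choose r) / real (N choose r) \<le> real (N - u) ^ r / real N ^ r"
    using assms by (simp add: divide_simps)
  also have "\<dots> = (1 - real u / real N) ^ r"
    using assms by (simp add: of_nat_diff diff_divide_distrib flip: power_divide)
  finally show "real ((N - u) choose r) / real (N choose r) \<le> (1 - real u / real N) ^ r" .
qed

end
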